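(* Let $(X,L)$ be a regular, hereditarily Lindelöf pretopological space. If Bob has a winning strategy in $\mathsf G_{\mathrm{fin}}(\mathcal C_L,\operatorname{Cov}(X))$, then $X$ is a countable union of $L$-compact subsets.
   Context: All filters are proper. $\operatorname{Fil}(X)$ is the set of filters on $X$, and $\dot x=\{A\subseteq X:x\in A\}$. A convergence on $X$ is a function $L:\operatorname{Fil}(X)\to\mathcal P(X)$ such that $x\in L(\dot x)$ for every $x\in X$, and $L(\mathcal F)\subseteq L(\mathcal G)$ whenever $\mathcal F\subseteq\mathcal G$; then $(X,L)$ is a convergence space. Write $\mathcal F\to_L x$ for $x\in L(\mathcal F)$, and $\Sigma_L=\{\mathcal F\in\operatorname{Fil}(X):L(\mathcal F)\neq\varnothing\}$. $L$ is a pretopology (and $(X,L)$ is pretopological) if for every $x\in X$ there is a least filter $\mathcal V_L(x)$ converging to $x$; equivalently $\mathcal F\to_Lx$ iff $\mathcal V_L(x)\subseteq\mathcal F$. For a filter $\mathcal F$ and a set $A$, $\mathcal F\mathrel{\#}A$ means $F\cap A\neq\varnothing$ for every $F\in\mathcal F$. Put $\operatorname{cl}_LA=\{x\in X:\mathcal F\to_Lx\text{ for some }\mathcal F\mathrel{\#}A\}$. $L$ is regular if $\mathcal F\to_L x$ implies that the filter generated by $\{\operatorname{cl}_LF:F\in\mathcal F\}$ also converges to $x$. A set $K\subseteq X$ is $L$-compact if every ultrafilter $\mathfrak p$ on $X$ with $K\in\mathfrak p$ satisfies $L(\mathfrak p)\cap K\neq\varnothing$. A family $\mathcal U\subseteq\mathcal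 P(X)$ is an $L$-cover if $\mathcal U\cap\mathcal F\neq\varnothing$ for every $\mathcal F\in\Sigma_L$; $\mathcal C_L$ is the family of all $L$-covers. $\operatorname{Cov}(X)$ is the family of all covers of $X$ by subsets of $X$. A subfamily $\mathcal V$ of an $L$-cover $\mathcal U$ is a basic subcovering if for every $\mathcal F\in\Sigma_L$ some finite $\mathcal E\subseteq\mathcal V$ satisfies $\bigcup\mathcal E\in\mathcal F$. A convergence space is Lindelöf (in Feldman's sense) if every $L$-cover has a countable basic subcovering. For $Y\subseteq X$ and $\mathcal F\in\operatorname{Fil}(Y)$ put $\mathcal F^{\uparrow X}=\{A\subseteq X:A\cap Y\in\mathcal F\}$; the subspace convergence $L|_Y$ on $Y$ is defined by $\mathcal F\to_{L|_Y}y$ iff $\mathcal F^{\uparrow X}\to_Ly$. $(X,L)$ is hereditarily Lindelöf if $(Y,L|_Y)$ is Lindelöf for every $Y\subseteq X$. In the game $\mathsf G_{\mathrm{fin}}(\mathcal A,\mathcal B)$, in each inning $n<\omega$ Alice chooses $\mathcal U_n\in\mathcal A$ and then Bob chooses a finite subfamily $\mathcal V_n\subseteq\mathcal U_n$; Bob wins if $\bigcup_{n<\omega}\mathcal V_n\in\mathcal B$, otherwise Alice wins. *)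

theory Defs
  imports Complex_Main "HOL-Library.Countable_Set"
begin

text \<open>
  The underlying set of a space is a carrier set \<open>X :: 'a set\<close>, so that every subset can carry its
  subspace convergence.  A proper filter on \<open>X\<close> is represented by a library filter
  \<open>F \<noteq> bot\<close> with \<open>F \<le> principal X\<close>; \<open>filter_sets X F\<close> is the corresponding family of subsets
  of \<open>X\<close>, and this is a bijection (lemma \<open>ex1_filter_on\<close>).  The library order is reverse
  inclusion of these families (lemma \<open>filter_sets_subset_iff\<close>): a finer filter is smaller.
\<close>

definition filters_on :: "'a set \<Rightarrow> 'a filter set" where
  "filters_on X = {F. F \<noteq> bot \<and> F \<le> principal X}"

definition filter_sets :: "'a set \<Rightarrow> 'a filter \<Rightarrow> 'a set set" where
  "filter_sets X F = {A. A \<subseteq> X \<and> eventually (\<lambda>x. x \<in> A) F}"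

lemma filter_sets_subset_iff:
  assumes "F \<in> filters_on X" "G \<in> filters_on X"
  shows "filter_sets X F \<subseteq> filter_sets X G \<longleftrightarrow> G \<le> F"
proof
  assume sub: "filter_sets X F \<subseteq> filter_sets X G"
  show "G \<le> F"
  proof (rule filter_leI)
    fix P assume P: "eventually P F"
    have "eventually (\<lambda>x. x \<in> X) F"
      using assms(1) by (auto simp: filters_on_def le_principal)
    then have "{x \<in> X. P x} \<in> filter_sets X F"
      using P by (auto simp: filter_sets_def elim: eventually_elim2)
    then have "eventually (\<lambda>x. x \<in> {x \<in> X. P x}) G"
      using sub unfolding filter_sets_def by blast
    then show "eventually P G" by (auto elim: eventually_mono)
  qed
qed (unfold filter_sets_def le_filter_def, blast)

lemma ex1_filter_on:
  assumes "\<A> \<subseteq> Pow X" "X \<in> \<A>" "{} \<notin> \<A>"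
    and inter: "\<And>A B. A \<in> \<A> \<Longrightarrow> B \<in> \<A> \<Longrightarrow> A \<inter> B \<in> \<A>"
    and up: "\<And>A B. A \<in> \<A> \<Longrightarrow> A \<subseteq> B \<Longrightarrow> B \<subseteq> X \<Longrightarrow> B \<in> \<A>"
  shows "\<exists>!F. F \<in> filters_on X \<and> filter_sets X F = \<A>"
proof (rule ex_ex1I)
  define F where "F = Abs_filter (\<lambda>P. {x \<in> X. P x} \<in> \<A>)"
  have "is_filter (\<lambda>P. {x \<in> X. P x} \<in> \<A>)"
  proof (rule is_filter.intro)
    show "{x \<in> X. True} \<in> \<A>" using assms(2) by simp
  next
    fix P Q assume "{x \<in> X. P x} \<in> \<A>" "{x \<in> X. Q x} \<in> \<A>"
    from inter[OF this] show "{x \<in> X. P x \<and> Q x} \<in> \<A>"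
      by (rule back_subst[of "\<lambda>S. S \<in> \<A>"]) auto
  next
    fix P Q assume "\<forall>x. P x \<longrightarrow> Q x" "{x \<in> X. P x} \<in> \<A>"
    then show "{x \<in> X. Q x} \<in> \<A>" by - (rule up, assumption, auto)
  qed
  then have ev: "eventually P F \<longleftrightarrow> {x \<in> X. P x} \<in> \<A>" for P
    unfolding F_def by (rule eventually_Abs_filter)
  have "F \<noteq> bot" using ev[of "\<lambda>_. False"] assms(3) by fastforce
  moreover have "F \<le> principal X" using ev[of "\<lambda>x. x \<in> X"] assms(2) by (simp add: le_principal)
  moreover have "filter_sets X F = \<A>"
  proof (rule set_eqI)
    fix A
    show "A \<in> filter_sets X F \<longleftrightarrow> A \<in> \<A>"
    proof (cases "A \<subseteq> X")
      case True
      then have "{x \<in> X. x \<in> A} = A" by blast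
      then show ?thesis using True unfolding filter_sets_def mem_Collect_eq ev by simp
    next
      case False
      then show ?thesis using assms(1) unfolding filter_sets_def by blast
    qed
  qed
  ultimately show "\<exists>F. F \<in> filters_on X \<and> filter_sets X F = \<A>"
    by (auto simp: filters_on_def)
next
  fix F G
  assume "F \<in> filters_on X \<and> filter_sets X F = \<A>" "G \<in> filters_on X \<and> filter_sets X G = \<A>"
  then show "F = G"
    using filter_sets_subset_iff[of F X G] filter_sets_subset_iff[of G X F]
    by (intro antisym) simp_all
qed

text \<open>Only the values of \<open>L\<close> on \<open>filters_on X\<close> matter.\<close>

definition convergence_space :: "'a set \<Rightarrow> ('a filter \<Rightarrow> 'a set) \<Rightarrow> bool" where
  "convergence_space X L \<longleftrightarrow>
     (\<forall>F \<in> filters_on X. L F \<subseteq> X) \<and>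
     (\<forall>x \<in> X. x \<in> L (principal {x})) \<and>
     (\<forall>F \<in> filters_on X. \<forall>G \<in> filters_on X.
        filter_sets X F \<subseteq> filter_sets X G \<longrightarrow> L F \<subseteq> L G)"

definition convergent_filters :: "'a set \<Rightarrow> ('a filter \<Rightarrow> 'a set) \<Rightarrow> 'a filter set" where
  "convergent_filters X L = {F \<in> filters_on X. L F \<noteq> {}}"

definition pretopological :: "'a set \<Rightarrow> ('a filter \<Rightarrow> 'a set) \<Rightarrow> bool" where
  "pretopological X L \<longleftrightarrow>
     (\<forall>x \<in> X. \<exists>V \<in> filters_on X. x \<in> L V \<and>
        (\<forall>F \<in> filters_on X. x \<in> L F \<longrightarrow> filter_sets X V \<subseteq> filter_sets X F))"

definition meshes :: "'a set \<Rightarrow> 'a filter \<Rightarrow> 'a set \<Rightarrow> bool" where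
  "meshes X F A \<longleftrightarrow> (\<forall>B \<in> filter_sets X F. B \<inter> A \<noteq> {})"

definition conv_closure :: "'a set \<Rightarrow> ('a filter \<Rightarrow> 'a set) \<Rightarrow> 'a set \<Rightarrow> 'a set" where
  "conv_closure X L A = {x \<in> X. \<exists>F \<in> filters_on X. meshes X F A \<and> x \<in> L F}"

text \<open>The filter generated by the sets \<open>conv_closure X L A\<close> (lemma \<open>filter_sets_closure_filter\<close>).\<close>

definition closure_filter :: "'a set \<Rightarrow> ('a filter \<Rightarrow> 'a set) \<Rightarrow> 'a filter \<Rightarrow> 'a filter" where
  "closure_filter X L F = (INF A \<in> filter_sets X F. principal (conv_closure X L A))"

lemma conv_closure_mono: "A \<subseteq> B \<Longrightarrow> conv_closure X L A \<subseteq> conv_closure X L B"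
proof
  fix x assume "A \<subseteq> B" "x \<in> conv_closure X L A"
  moreover have "meshes X F A \<Longrightarrow> A \<subseteq> B \<Longrightarrow> meshes X F B" for F
    unfolding meshes_def by (meson disjoint_iff in_mono)
  ultimately show "x \<in> conv_closure X L B"
    unfolding conv_closure_def by blast
qed

lemma filter_sets_closure_filter:
  assumes "F \<in> filters_on X"
  shows "filter_sets X (closure_filter X L F) =
    {B. B \<subseteq> X \<and> (\<exists>A \<in> filter_sets X F. conv_closure X L A \<subseteq> B)}"
proof -
  have ne: "filter_sets X F \<noteq> {}"
    using assms by (auto simp: filters_on_def filter_sets_def le_principal)
  have inter: "A \<inter> B \<in> filter_sets X F" if "A \<in> filter_sets X F" "B \<in> filter_sets X F" for A B
    using that by (auto simp: filter_sets_def eventually_conj_iff)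
  have "eventually P (closure_filter X L F) \<longleftrightarrow>
      (\<exists>A \<in> filter_sets X F. eventually P (principal (conv_closure X L A)))" for P
    unfolding closure_filter_def
  proof (rule eventually_INF_base[OF ne])
    fix A B assume AB: "A \<in> filter_sets X F" "B \<in> filter_sets X F"
    show "\<exists>C \<in> filter_sets X F. principal (conv_closure X L C) \<le>
        inf (principal (conv_closure X L A)) (principal (conv_closure X L B))"
      using inter[OF AB] conv_closure_mono[of "A \<inter> B" A X L] conv_closure_mono[of "A \<inter> B" B X L]
      by (intro bexI[of _ "A \<inter> B"]) auto
  qed
  then show ?thesis
    unfolding filter_sets_def[of X "closure_filter X L F"] by (auto simp: eventually_principal)
qed

definition regular_convergence :: "'a set \<Rightarrow> ('a filter \<Rightarrow> 'a set) \<Rightarrow> bool" where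
  "regular_convergence X L \<longleftrightarrow>
     (\<forall>F \<in> filters_on X. \<forall>x. x \<in> L F \<longrightarrow> x \<in> L (closure_filter X L F))"

definition ultrafilters_on :: "'a set \<Rightarrow> 'a filter set" where
  "ultrafilters_on X = {p \<in> filters_on X.
     \<forall>F \<in> filters_on X. filter_sets X p \<subseteq> filter_sets X F \<longrightarrow> F = p}"

definition conv_compact :: "'a set \<Rightarrow> ('a filter \<Rightarrow> 'a set) \<Rightarrow> 'a set \<Rightarrow> bool" where
  "conv_compact X L K \<longleftrightarrow>
     K \<subseteq> X \<and> (\<forall>p \<in> ultrafilters_on X. K \<in> filter_sets X p \<longrightarrow> L p \<inter> K \<noteq> {})"

definition conv_covers :: "'a set \<Rightarrow> ('a filter \<Rightarrow> 'a set) \<Rightarrow> 'a set set set" where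
  "conv_covers X L =
     {\<U>. \<U> \<subseteq> Pow X \<and> (\<forall>F \<in> convergent_filters X L. \<U> \<inter> filter_sets X F \<noteq> {})}"

definition set_covers :: "'a set \<Rightarrow> 'a set set set" where
  "set_covers X = {\<U>. \<U> \<subseteq> Pow X \<and> \<Union>\<U> = X}"

definition basic_subcovering ::
  "'a set \<Rightarrow> ('a filter \<Rightarrow> 'a set) \<Rightarrow> 'a set set \<Rightarrow> 'a set set \<Rightarrow> bool" where
  "basic_subcovering X L \<U> \<V> \<longleftrightarrow> \<V> \<subseteq> \<U> \<and>
     (\<forall>F \<in> convergent_filters X L. \<exists>\<E>. finite \<E> \<and> \<E> \<subseteq> \<V> \<and> \<Union>\<E> \<in> filter_sets X F)"

definition conv_Lindelof :: "'a set \<Rightarrow> ('a filter \<Rightarrow> 'a set) \<Rightarrow> bool" where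
  "conv_Lindelof X L \<longleftrightarrow>
     (\<forall>\<U> \<in> conv_covers X L. \<exists>\<V>. countable \<V> \<and> basic_subcovering X L \<U> \<V>)"

text \<open>
  For \<open>Y \<subseteq> X\<close>, extending a filter on \<open>Y\<close> to \<open>X\<close> does not change the library filter representing it
  (lemma \<open>filter_sets_extension\<close>), hence \<open>L F\<close> below is the set of limits of the extended filter.
\<close>

lemma filter_sets_extension:
  assumes "Y \<subseteq> X" "F \<in> filters_on Y"
  shows "F \<in> filters_on X" "filter_sets X F = {A. A \<subseteq> X \<and> A \<inter> Y \<in> filter_sets Y F}"
proof -
  have Y: "eventually (\<lambda>x. x \<in> Y) F" using assms(2) by (auto simp: filters_on_def le_principal)
  then show "F \<in> filters_on X"
    using assms by (auto simp: filters_on_def le_principal elim: eventually_mono)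
  show "filter_sets X F = {A. A \<subseteq> X \<and> A \<inter> Y \<in> filter_sets Y F}"
    using Y by (auto simp: filter_sets_def eventually_conj_iff)
qed

definition subspace_convergence ::
  "('a filter \<Rightarrow> 'a set) \<Rightarrow> 'a set \<Rightarrow> 'a filter \<Rightarrow> 'a set" where
  "subspace_convergence L Y F = {y \<in> Y. y \<in> L F}"

definition hereditarily_Lindelof :: "'a set \<Rightarrow> ('a filter \<Rightarrow> 'a set) \<Rightarrow> bool" where
  "hereditarily_Lindelof X L \<longleftrightarrow> (\<forall>Y \<subseteq> X. conv_Lindelof Y (subspace_convergence L Y))"

text \<open>
  A strategy for Bob maps the nonempty list of Alice's moves so far to Bob's answer; his own
  earlier moves are determined by the strategy and need not be recorded.
\<close>

definition Gfin_Bob_winning_strategy ::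
  "'b set set \<Rightarrow> 'b set set \<Rightarrow> ('b set list \<Rightarrow> 'b set) \<Rightarrow> bool" where
  "Gfin_Bob_winning_strategy \<A> \<B> \<sigma> \<longleftrightarrow>
     (\<forall>\<U> :: nat \<Rightarrow> 'b set. (\<forall>n. \<U> n \<in> \<A>) \<longrightarrow>
        (\<forall>n. finite (\<sigma> (map \<U> [0..<Suc n])) \<and> \<sigma> (map \<U> [0..<Suc n]) \<subseteq> \<U> n) \<and>
        (\<Union>n. \<sigma> (map \<U> [0..<Suc n])) \<in> \<B>)"

end

theory Submission
  imports Defs
begin

text \<open>
  For a position \<open>s\<close> of the game let \<open>K s\<close> be the set of points that lie in the closure of Bob's
  answer to \<open>s @ [\<U>]\<close> for every cover \<open>\<U>\<close>.  Closure need not be idempotent, so \<open>K s\<close> itself may fail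
  to be compact, but its closure is compact: shrink neighbourhoods twice by regularity and let
  Alice play the resulting cover.  By the hereditary Lindelof property, countably many covers per
  position already witness \<open>x \<notin> K s\<close>; following them yields a countable tree of positions.  A
  point outside all \<open>K s\<close> of this tree would determine a play in which Bob never covers it.
\<close>

text \<open>If the complement of \<open>A\<close> is not in \<open>p\<close>, the trace of
  \<open>p\<close> on \<open>A\<close> is a proper filter finer than \<open>p\<close>, so maximality
  makes it equal to \<open>p\<close>.\<close>

lemma ultrafilters_on_cases:
  assumes "p \<in> ultrafilters_on X"
  shows "eventually (\<lambda>x. x \<in> A) p \<or> eventually (\<lambda>x. x \<notin> A) p"
proof (rule disjCI)
  assume n: "\<not> eventually (\<lambda>x. x \<notin> A) p"
  let ?q = "inf p (principal A)"
  have p: "p \<in> filters_on X" using assms by (simp add: ultrafilters_on_def)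
  have "?q \<noteq> bot"
    using n by (simp add: trivial_limit_def eventually_inf_principal)
  moreover have "?q \<le> principal X"
    using p by (simp add: filters_on_def le_infI1)
  ultimately have q: "?q \<in> filters_on X"
    by (simp add: filters_on_def)
  have "filter_sets X p \<subseteq> filter_sets X ?q"
    using filter_sets_subset_iff[OF p q] by simp
  then have "?q = p"
    using assms q unfolding ultrafilters_on_def by blast
  then have "p \<le> principal A"
    by (metis inf_le2)
  then show "eventually (\<lambda>x. x \<in> A) p"
    by (simp add: le_principal)
qed

section \<open>Closure, covers and regularity in terms of neighbourhood filters\<close>

text \<open>A pretopology presented by a choice of its least convergent filters. As the order is
  reversed, \<open>F \<le> V x\<close> says that \<open>F\<close> contains every neighbourhood of
  \<open>x\<close>.\<close>

locale nbhd_filters =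
  fixes X :: "'a set" and L :: "'a filter \<Rightarrow> 'a set" and V :: "'a \<Rightarrow> 'a filter"
  assumes V_filter: "x \<in> X \<Longrightarrow> V x \<in> filters_on X"
    and lim_iff: "F \<in> filters_on X \<Longrightarrow> x \<in> L F \<longleftrightarrow> x \<in> X \<and> F \<le> V x"
    and point_le_V: "x \<in> X \<Longrightarrow> principal {x} \<le> V x"
begin

lemma eventually_V_in_X: "x \<in> X \<Longrightarrow> eventually (\<lambda>y. y \<in> X) (V x)"
  using V_filter by (simp add: filters_on_def le_principal)

text \<open>Among the filters converging to \<open>x\<close>, \<open>V x\<close> has the fewest
  members, so it meshes with \<open>A\<close> as soon as one of them does.\<close>

lemma conv_closure_iff:
  "x \<in> conv_closure X L A \<longleftrightarrow> x \<in> X \<and> \<not> eventually (\<lambda>y. y \<notin> A) (V x)"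
proof (cases "x \<in> X")
  case x: True
  show ?thesis
  proof
    assume "x \<in> conv_closure X L A"
    then obtain F where F: "F \<in> filters_on X" "meshes X F A" "F \<le> V x"
      unfolding conv_closure_def using lim_iff by blast
    have "\<not> eventually (\<lambda>y. y \<notin> A) (V x)"
    proof
      assume "eventually (\<lambda>y. y \<notin> A) (V x)"
      with eventually_V_in_X[OF x] have "eventually (\<lambda>y. y \<in> X - A) (V x)"
        by (auto elim: eventually_elim2)
      then have "X - A \<in> filter_sets X F"
        using F(3) by (auto simp: filter_sets_def le_filter_def)
      then show False using F(2) unfolding meshes_def by blast
    qed
    with x show "x \<in> X \<and> \<not> eventually (\<lambda>y. y \<notin> A) (V x)" by blast
  next
    assume n: "x \<in> X \<and> \<not> eventually (\<lambda>y. y \<notin> A) (V x)"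
    have "meshes X (V x) A"
      unfolding meshes_def
    proof (intro ballI notI)
      fix B assume "B \<in> filter_sets X (V x)" "B \<inter> A = {}"
      then have "eventually (\<lambda>y. y \<notin> A) (V x)"
        by (auto simp: filter_sets_def elim!: eventually_mono)
      with n show False by blast
    qed
    then show "x \<in> conv_closure X L A"
      using x V_filter[OF x] lim_iff[OF V_filter[OF x]] unfolding conv_closure_def by blast
  qed
qed (simp add: conv_closure_def)

lemma subset_conv_closure: "A \<subseteq> X \<Longrightarrow> A \<subseteq> conv_closure X L A"
  using point_le_V by (fastforce simp: conv_closure_iff le_filter_def eventually_principal)

text \<open>A point outside every closure has, for each \<open>A\<close> in the finite family, a
  neighbourhood missing \<open>A\<close>; their intersection misses the union.\<close>

lemma conv_closure_Union_subset:
  assumes "finite \<F>" "\<And>A. A \<in> \<F> \<Longrightarrow> conv_closure X L A \<subseteq> B"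
  shows "conv_closure X L (\<Union>\<F>) \<subseteq> B"
proof
  fix x assume x: "x \<in> conv_closure X L (\<Union>\<F>)"
  show "x \<in> B"
  proof (rule ccontr)
    assume "x \<notin> B"
    then have "\<forall>A\<in>\<F>. eventually (\<lambda>y. y \<notin> A) (V x)"
      using assms(2) x unfolding conv_closure_iff subset_iff by blast
    then have "eventually (\<lambda>y. \<forall>A\<in>\<F>. y \<notin> A) (V x)"
      by (rule eventually_ball_finite[OF assms(1)])
    then show False using x by (simp add: conv_closure_iff)
  qed
qed

lemma conv_coversI:
  assumes "\<U> \<subseteq> Pow X" "\<And>x. x \<in> X \<Longrightarrow> \<exists>U\<in>\<U>. eventually (\<lambda>y. y \<in> U) (V x)"
  shows "\<U> \<in> conv_covers X L"
  unfolding conv_covers_def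
proof (intro CollectI conjI ballI assms(1))
  fix F assume "F \<in> convergent_filters X L"
  then obtain x where "x \<in> X" "F \<le> V x"
    unfolding convergent_filters_def using lim_iff by blast
  with assms(2) obtain U where "U \<in> \<U>" "eventually (\<lambda>y. y \<in> U) F"
    unfolding le_filter_def by blast
  with assms(1) show "\<U> \<inter> filter_sets X F \<noteq> {}"
    unfolding filter_sets_def by blast
qed

text \<open>Regularity, applied to \<open>V x\<close>, makes its closure filter converge to
  \<open>x\<close>. By leastness of \<open>V x\<close>, every neighbourhood then contains the
  closure of another one.\<close>

lemma regular_nbhd:
  assumes "regular_convergence X L" "x \<in> X" "eventually (\<lambda>y. y \<in> U) (V x)"
  obtains W where "W \<subseteq> X" "eventually (\<lambda>y. y \<in> W) (V x)" "conv_closure X L W \<subseteq> U"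
proof -
  let ?C = "closure_filter X L (V x)"
  note Vx = V_filter[OF assms(2)]
  \<comment> \<open>Passing to closures enlarges sets, so \<open>?C\<close> is coarser than
    \<open>V x\<close> and therefore proper.\<close>
  have "V x \<le> ?C"
    unfolding closure_filter_def
  proof (rule INF_greatest)
    fix A assume "A \<in> filter_sets X (V x)"
    then have "A \<subseteq> X" "V x \<le> principal A" by (simp_all add: filter_sets_def le_principal)
    moreover from this(1) have "principal A \<le> principal (conv_closure X L A)"
      by (simp add: subset_conv_closure)
    ultimately show "V x \<le> principal (conv_closure X L A)" by (blast intro: order_trans)
  qed
  then have "?C \<noteq> bot" using Vx by (auto simp: filters_on_def le_bot)
  moreover have "X \<in> filter_sets X (V x)"
    using eventually_V_in_X[OF assms(2)] by (simp add: filter_sets_def)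
  then have "X \<in> filter_sets X ?C"
    unfolding filter_sets_closure_filter[OF Vx] conv_closure_def by blast
  ultimately have C: "?C \<in> filters_on X"
    by (simp add: filters_on_def le_principal filter_sets_def)
  have "x \<in> L (V x)" using lim_iff[OF Vx] assms(2) by blast
  then have "x \<in> L ?C" using assms(1) Vx unfolding regular_convergence_def by blast
  then have "?C \<le> V x" using lim_iff[OF C] by blast
  moreover have "eventually (\<lambda>y. y \<in> U \<inter> X) (V x)"
    using assms(3) eventually_V_in_X[OF assms(2)] by (simp add: eventually_conj_iff)
  ultimately have "U \<inter> X \<in> filter_sets X ?C"
    by (simp add: filter_sets_def le_filter_def)
  then obtain W where "W \<in> filter_sets X (V x)" "conv_closure X L W \<subseteq> U \<inter> X"
    unfolding filter_sets_closure_filter[OF Vx] by blast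
  then show thesis
    by (intro that[of W]) (auto simp: filter_sets_def)
qed

section \<open>Compactness of closures and countable separation\<close>

text \<open>Suppose an ultrafilter \<open>p\<close> contains the closure of \<open>K\<close> but has
  no limit there. Neighbourhoods \<open>W x\<close> small enough to survive two closures give, via
  \<open>fin\<close>, finitely many sets outside \<open>p\<close> that cover the closure of
  \<open>K\<close>. This avoids any appeal to idempotence.\<close>

lemma conv_compact_closure:
  assumes reg: "regular_convergence X L" and "K \<subseteq> X"
    and fin: "\<And>\<U>. \<U> \<in> conv_covers X L \<Longrightarrow>
      \<exists>\<F>. finite \<F> \<and> \<F> \<subseteq> \<U> \<and> K \<subseteq> conv_closure X L (\<Union>\<F>)"
  shows "conv_compact X L (conv_closure X L K)"
  unfolding conv_compact_def
proof (intro conjI ballI impI notI)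
  fix p assume p: "p \<in> ultrafilters_on X" and Kp: "conv_closure X L K \<in> filter_sets X p"
    and empty: "L p \<inter> conv_closure X L K = {}"
  have pf: "p \<in> filters_on X" using p by (simp add: ultrafilters_on_def)
  have "\<exists>W T. W \<subseteq> X \<and> eventually (\<lambda>y. y \<in> W) (V x) \<and> conv_closure X L W \<subseteq> T \<and>
      (T \<inter> K = {} \<or> eventually (\<lambda>y. y \<notin> conv_closure X L T) p)" if x: "x \<in> X" for x
  proof (cases "x \<in> conv_closure X L K")
    case True
    with empty have "x \<notin> L p" by blast
    with x lim_iff[OF pf] have "\<not> p \<le> V x" by blast
    then obtain P where P: "eventually P (V x)" "\<not> eventually P p"
      unfolding le_filter_def by blast
    then have U: "eventually (\<lambda>y. y \<in> Collect P) (V x)" "eventually (\<lambda>y. y \<notin> Collect P) p"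
      using ultrafilters_on_cases[OF p, of "Collect P"] by auto
    \<comment> \<open>The room between \<open>T\<close> and \<open>Collect P\<close> pays for the
      closure taken of \<open>K\<close>; that between \<open>W\<close> and \<open>T\<close>,
      obtained next, pays for the closure in \<open>fin\<close>.\<close>
    obtain T where T: "eventually (\<lambda>y. y \<in> T) (V x)" "conv_closure X L T \<subseteq> Collect P"
      by (rule regular_nbhd[OF reg x U(1)])
    obtain W where W: "W \<subseteq> X" "eventually (\<lambda>y. y \<in> W) (V x)" "conv_closure X L W \<subseteq> T"
      by (rule regular_nbhd[OF reg x T(1)])
    have "eventually (\<lambda>y. y \<notin> conv_closure X L T) p"
      using U(2) by (rule eventually_mono) (use T(2) in blast)
    with W show ?thesis by blast
  next
    case False
    with x have "eventually (\<lambda>y. y \<in> - K) (V x)" by (simp add: conv_closure_iff)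
    \<comment> \<open>Here \<open>T\<close> is \<open>- K\<close>, which gives the first alternative
      of the disjunction.\<close>
    then obtain W where "W \<subseteq> X" "eventually (\<lambda>y. y \<in> W) (V x)" "conv_closure X L W \<subseteq> - K"
      by (rule regular_nbhd[OF reg x])
    then show ?thesis by blast
  qed
  then obtain W T where W: "\<And>x. x \<in> X \<Longrightarrow> W x \<subseteq> X"
      "\<And>x. x \<in> X \<Longrightarrow> eventually (\<lambda>y. y \<in> W x) (V x)"
    and T: "\<And>x. x \<in> X \<Longrightarrow> conv_closure X L (W x) \<subseteq> T x"
      "\<And>x. x \<in> X \<Longrightarrow> T x \<inter> K = {} \<or> eventually (\<lambda>y. y \<notin> conv_closure X L (T x)) p"
    by metis
  have "W ` X \<in> conv_covers X L"
    by (rule conv_coversI) (use W in blast)+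
  from fin[OF this] obtain \<F> where \<F>: "finite \<F>" "\<F> \<subseteq> W ` X" "K \<subseteq> conv_closure X L (\<Union>\<F>)"
    by blast
  then obtain I where I: "finite I" "I \<subseteq> X" "\<F> = W ` I"
    using finite_subset_image[OF \<F>(1,2)] by blast
  \<comment> \<open>Indices whose \<open>T i\<close> misses \<open>K\<close> contribute nothing to
    covering \<open>K\<close>; for the remaining ones \<open>p\<close> avoids the closure of
    \<open>T i\<close>.\<close>
  define J where "J = {i \<in> I. T i \<inter> K \<noteq> {}}"
  have J: "finite J" "J \<subseteq> X" using I by (auto simp: J_def)
  have "conv_closure X L (\<Union>\<F>) \<subseteq> \<Union>(T ` I)"
    by (rule conv_closure_Union_subset[OF \<F>(1)]) (use I T(1) in blast)
  with \<F>(3) have "K \<subseteq> \<Union>(T ` I)" by (rule order_trans)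
  then have "K \<subseteq> \<Union>(T ` J)"
    unfolding J_def by blast
  then have "conv_closure X L K \<subseteq> conv_closure X L (\<Union>(T ` J))"
    by (rule conv_closure_mono)
  also have "\<dots> \<subseteq> (\<Union>i\<in>J. conv_closure X L (T i))"
    by (rule conv_closure_Union_subset) (use J in auto)
  finally have sub: "conv_closure X L K \<subseteq> (\<Union>i\<in>J. conv_closure X L (T i))" .
  have "\<forall>i\<in>J. eventually (\<lambda>y. y \<notin> conv_closure X L (T i)) p"
    using T(2) J(2) unfolding J_def by blast
  then have "eventually (\<lambda>y. \<forall>i\<in>J. y \<notin> conv_closure X L (T i)) p"
    by (rule eventually_ball_finite[OF J(1)])
  moreover have "eventually (\<lambda>y. y \<in> conv_closure X L K) p"
    using Kp by (simp add: filter_sets_def)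
  ultimately have "eventually (\<lambda>y. False) p"
    by eventually_elim (use sub in blast)
  then show False using pf by (simp add: filters_on_def)
qed (auto simp: conv_closure_def)

text \<open>On the subspace \<open>Y\<close> of points outside some closure, the sets
  \<open>Y - A i\<close> form a cover in the sense of the convergence, because \<open>V y\<close>
  avoids some \<open>A i\<close>. A countable basic subcovering supplies \<open>D\<close>. The
  conclusion concerns \<open>A j\<close> and not its closure, since only points are
  recovered.\<close>

lemma hereditarily_Lindelof_countable_separation:
  assumes "hereditarily_Lindelof X L"
  obtains D where "countable D" "D \<subseteq> I"
    "\<And>x i. x \<in> X \<Longrightarrow> i \<in> I \<Longrightarrow> x \<notin> conv_closure X L (A i) \<Longrightarrow> \<exists>j\<in>D. x \<notin> A j"
proof -
  define Y where "Y = {x \<in> X. \<exists>i\<in>I. x \<notin> conv_closure X L (A i)}"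
  let ?M = "subspace_convergence L Y"
  have YX: "Y \<subseteq> X" by (auto simp: Y_def)
  have "(\<lambda>i. Y - A i) ` I \<in> conv_covers Y ?M"
    unfolding conv_covers_def
  proof (intro CollectI conjI ballI)
    fix F assume "F \<in> convergent_filters Y ?M"
    then obtain y where F: "F \<in> filters_on Y" and y: "y \<in> Y" "y \<in> L F"
      by (auto simp: convergent_filters_def subspace_convergence_def)
    have le: "F \<le> V y"
      using lim_iff[OF filter_sets_extension(1)[OF YX F]] y(2) by blast
    obtain i where i: "i \<in> I" "eventually (\<lambda>z. z \<notin> A i) (V y)"
      using y(1) by (auto simp: Y_def conv_closure_iff)
    have "eventually (\<lambda>z. z \<in> Y) F"
      using F by (simp add: filters_on_def le_principal)
    moreover have "eventually (\<lambda>z. z \<notin> A i) F"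
      using le i(2) by (simp add: le_filter_def)
    ultimately have "Y - A i \<in> filter_sets Y F"
      by (simp add: filter_sets_def eventually_conj_iff)
    with i(1) show "(\<lambda>i. Y - A i) ` I \<inter> filter_sets Y F \<noteq> {}" by blast
  qed auto
  moreover have "conv_Lindelof Y ?M"
    using assms YX by (simp add: hereditarily_Lindelof_def)
  ultimately obtain \<V> where \<V>: "countable \<V>" "basic_subcovering Y ?M ((\<lambda>i. Y - A i) ` I) \<V>"
    unfolding conv_Lindelof_def by blast
  then obtain D where D: "countable D" "D \<subseteq> I" "\<V> = (\<lambda>i. Y - A i) ` D"
    unfolding basic_subcovering_def by (metis countable_subset_image)
  show thesis
  proof (rule that[OF D(1,2)])
    fix x i assume "x \<in> X" "i \<in> I" "x \<notin> conv_closure X L (A i)"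
    then have xY: "x \<in> Y" by (auto simp: Y_def)
    \<comment> \<open>Testing the basic subcovering on the point filter at \<open>x\<close> shows
      that some member of \<open>\<V>\<close> contains \<open>x\<close>.\<close>
    then have "principal {x} \<in> filters_on Y" "principal {x} \<in> filters_on X"
      using YX by (auto simp: filters_on_def principal_eq_bot_iff)
    then have "principal {x} \<in> convergent_filters Y ?M"
      using lim_iff point_le_V \<open>x \<in> X\<close> xY
      by (auto simp: convergent_filters_def subspace_convergence_def)
    then obtain \<E> where "\<E> \<subseteq> \<V>" "\<Union>\<E> \<in> filter_sets Y (principal {x})"
      using \<V>(2) unfolding basic_subcovering_def by blast
    then show "\<exists>j\<in>D. x \<notin> A j"
      using D(3) by (auto simp: filter_sets_def eventually_principal)
  qed
qed

end

section \<open>Choice of neighbourhood filters, and legal positions of the game\<close>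

lemma pretopological_nbhd_filters:
  assumes "convergence_space X L" "pretopological X L"
  shows "\<exists>V. nbhd_filters X L V"
proof -
  have "\<forall>x\<in>X. \<exists>V. V \<in> filters_on X \<and> x \<in> L V \<and> (\<forall>F\<in>filters_on X. x \<in> L F \<longrightarrow> F \<le> V)"
    using assms(2) unfolding pretopological_def by (metis filter_sets_subset_iff)
  then obtain V where V: "\<And>x. x \<in> X \<Longrightarrow> V x \<in> filters_on X" "\<And>x. x \<in> X \<Longrightarrow> x \<in> L (V x)"
    "\<And>x F. x \<in> X \<Longrightarrow> F \<in> filters_on X \<Longrightarrow> x \<in> L F \<Longrightarrow> F \<le> V x"
    by metis
  have mono: "L F \<subseteq> L G" if "F \<in> filters_on X" "G \<in> filters_on X" "G \<le> F" for F G
    using assms(1) that unfolding convergence_space_def by (metis filter_sets_subset_iff)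
  have "nbhd_filters X L V"
  proof
    fix x F assume F: "F \<in> filters_on X"
    then have "L F \<subseteq> X" using assms(1) by (auto simp: convergence_space_def)
    then show "x \<in> L F \<longleftrightarrow> x \<in> X \<and> F \<le> V x"
      using V mono[OF _ F] F by blast
  next
    fix x assume x: "x \<in> X"
    then have "principal {x} \<in> filters_on X"
      by (simp add: filters_on_def principal_eq_bot_iff)
    with x show "principal {x} \<le> V x"
      using V(3) assms(1) by (simp add: convergence_space_def)
  qed (rule V(1))
  then show ?thesis by (intro exI)
qed

text \<open>A winning strategy is constrained only along infinite plays, so the finite position is
  completed to one.\<close>

lemma Gfin_Bob_winning_strategy_legal:
  assumes "Gfin_Bob_winning_strategy \<A> \<B> \<sigma>" "set s \<subseteq> \<A>" "U \<in> \<A>"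
  shows "finite (\<sigma> (s @ [U]))" "\<sigma> (s @ [U]) \<subseteq> U"
proof -
  \<comment> \<open>Alice repeats \<open>U\<close> forever after \<open>s\<close>; its first
    occurrence is inning \<open>length s\<close>.\<close>
  define u where "u n = (if n < length s then s ! n else U)" for n
  have "\<forall>n. u n \<in> \<A>" using assms(2,3) by (auto simp: u_def)
  moreover have "map u [0..<Suc (length s)] = s @ [U]"
    by (rule nth_equalityI) (auto simp: u_def nth_append less_Suc_eq)
  moreover have "u (length s) = U" by (simp add: u_def)
  ultimately show "finite (\<sigma> (s @ [U]))" "\<sigma> (s @ [U]) \<subseteq> U"
    using assms(1) unfolding Gfin_Bob_winning_strategy_def by metis+
qed

theorem corollary4p8:
  fixes X :: "'a set" and L :: "'a filter \<Rightarrow> 'a set"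
  assumes "convergence_space X L"
    and "pretopological X L"
    and "regular_convergence X L"
    and "hereditarily_Lindelof X L"
    and "\<exists>\<sigma>. Gfin_Bob_winning_strategy (conv_covers X L) (set_covers X) \<sigma>"
  shows "\<exists>\<K>. countable \<K> \<and> (\<forall>K \<in> \<K>. conv_compact X L K) \<and> \<Union>\<K> = X"
proof -
  obtain V where "nbhd_filters X L V"
    using pretopological_nbhd_filters[OF assms(1,2)] ..
  then interpret nbhd_filters X L V .
  obtain \<sigma> where \<sigma>: "Gfin_Bob_winning_strategy (conv_covers X L) (set_covers X) \<sigma>"
    using assms(5) ..
  define K where
    "K s = {x \<in> X. \<forall>\<U>\<in>conv_covers X L. x \<in> conv_closure X L (\<Union>(\<sigma> (s @ [\<U>])))}" for s
  have compact: "conv_compact X L (conv_closure X L (K s))" if "set s \<subseteq> conv_covers X L" for s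
  proof (rule conv_compact_closure[OF assms(3)])
    fix \<U> assume "\<U> \<in> conv_covers X L"
    with Gfin_Bob_winning_strategy_legal[OF \<sigma> that]
    show "\<exists>\<F>. finite \<F> \<and> \<F> \<subseteq> \<U> \<and> K s \<subseteq> conv_closure X L (\<Union>\<F>)"
      \<comment> \<open>Bob's answer to \<open>\<U>\<close> at position \<open>s\<close> is itself
        the required finite family.\<close>
      by (intro exI[of _ "\<sigma> (s @ [\<U>])"]) (auto simp: K_def)
  qed (auto simp: K_def)
  have "\<exists>D. countable D \<and> D \<subseteq> conv_covers X L \<and>
      (\<forall>x\<in>X - K s. \<exists>\<U>\<in>D. x \<notin> \<Union>(\<sigma> (s @ [\<U>])))" for s
  proof -
    obtain D where D: "countable D" "D \<subseteq> conv_covers X L"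
      "\<And>x \<U>. x \<in> X \<Longrightarrow> \<U> \<in> conv_covers X L \<Longrightarrow>
        x \<notin> conv_closure X L (\<Union>(\<sigma> (s @ [\<U>]))) \<Longrightarrow> \<exists>\<U>\<in>D. x \<notin> \<Union>(\<sigma> (s @ [\<U>]))"
      \<comment> \<open>The index set is the family of all covers, each indexing the union of Bob's
        answer to it.\<close>
      using hereditarily_Lindelof_countable_separation[OF assms(4),
          of "conv_covers X L" "\<lambda>\<U>. \<Union>(\<sigma> (s @ [\<U>]))"] by metis
    have "\<exists>\<U>\<in>D. x \<notin> \<Union>(\<sigma> (s @ [\<U>]))" if "x \<in> X - K s" for x
    proof -
      from that have "x \<in> X" by simp
      moreover from that obtain \<U> where "\<U> \<in> conv_covers X L"
        "x \<notin> conv_closure X L (\<Union>(\<sigma> (s @ [\<U>])))"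
        unfolding K_def by auto
      ultimately show ?thesis by (rule D(3))
    qed
    with D(1,2) show ?thesis by (intro exI[of _ D] conjI ballI)
  qed
  then obtain D where D: "\<And>s. countable (D s)" "\<And>s. D s \<subseteq> conv_covers X L"
    "\<And>s x. x \<in> X \<Longrightarrow> x \<notin> K s \<Longrightarrow> \<exists>\<U>\<in>D s. x \<notin> \<Union>(\<sigma> (s @ [\<U>]))"
    by (metis DiffI)
  \<comment> \<open>Iteration replaces recursion on \<open>n\<close>: \<open>level n\<close> holds
    the positions after \<open>n\<close> moves of Alice, each move \<open>\<U>\<close> being taken
    from the countable set \<open>D s\<close> at the current position \<open>s\<close>.\<close>
  define level where
    "level n = ((\<lambda>S. \<Union>s\<in>S. (\<lambda>\<U>. s @ [\<U>]) ` D s) ^^ n) {[]}" for n :: nat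
  have level_0: "level 0 = {[]}"
    and level_Suc: "level (Suc n) = (\<Union>s\<in>level n. (\<lambda>\<U>. s @ [\<U>]) ` D s)" for n
    by (simp_all add: level_def)
  have countable: "countable (level n)" for n
    by (induction n) (auto simp: level_0 level_Suc D(1))
  have legal: "s \<in> level n \<Longrightarrow> set s \<subseteq> conv_covers X L" for s n
  proof (induction n arbitrary: s)
    case (Suc n)
    then obtain s' \<U> where s: "s' \<in> level n" "\<U> \<in> D s'" "s = s' @ [\<U>]"
      by (auto simp: level_Suc)
    from Suc.IH[OF s(1)] D(2)[of s'] s(2,3) show ?case by auto
  qed (simp add: level_0)
  have covered: "\<exists>n. \<exists>s\<in>level n. x \<in> K s" if x: "x \<in> X" for x
  proof (rule ccontr)
    assume none: "\<nexists>n. \<exists>s\<in>level n. x \<in> K s"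
    \<comment> \<open>A branch of the tree is built by dependent choice: since \<open>x\<close> lies
      in no \<open>K s\<close>, each node has a successor at which Bob's answer misses
      \<open>x\<close>.\<close>
    have "\<exists>t. \<forall>n. t n \<in> level n \<and>
        (\<exists>\<U>. t (Suc n) = t n @ [\<U>] \<and> \<U> \<in> conv_covers X L \<and> x \<notin> \<Union>(\<sigma> (t n @ [\<U>])))"
    proof (rule dependent_nat_choice)
      fix s n assume s: "s \<in> level n"
      then obtain \<U> where "\<U> \<in> D s" "x \<notin> \<Union>(\<sigma> (s @ [\<U>]))"
        using none D(3)[OF x] by blast
      with s D(2) show "\<exists>s'. s' \<in> level (Suc n) \<and>
          (\<exists>\<U>. s' = s @ [\<U>] \<and> \<U> \<in> conv_covers X L \<and> x \<notin> \<Union>(\<sigma> (s @ [\<U>])))"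
        unfolding level_Suc by blast
    qed (simp add: level_0)
    then obtain t u where t: "t 0 \<in> level 0" "\<And>n. t (Suc n) = t n @ [u n]"
      and u: "\<And>n. u n \<in> conv_covers X L" "\<And>n. x \<notin> \<Union>(\<sigma> (t (Suc n)))"
      by metis
    \<comment> \<open>The branch is the sequence of initial segments of the play \<open>u\<close>.
      Bob's answer in inning \<open>n\<close> is read at \<open>t (Suc n)\<close>, which includes
      the move \<open>u n\<close>.\<close>
    have tu: "t n = map u [0..<n]" for n
      by (induction n) (use t in \<open>auto simp: level_0\<close>)
    have "(\<Union>n. \<sigma> (t (Suc n))) \<in> set_covers X"
      using \<sigma> u(1) unfolding Gfin_Bob_winning_strategy_def tu by blast
    then have "x \<in> \<Union>(\<Union>n. \<sigma> (t (Suc n)))"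
      using x by (simp add: set_covers_def)
    with u(2) show False by blast
  qed
  \<comment> \<open>The closures are used because they are known to be compact; they still cover
    \<open>X\<close>, as each contains its \<open>K s\<close>.\<close>
  define \<K> where "\<K> = (\<lambda>s. conv_closure X L (K s)) ` (\<Union>n. level n)"
  have K_closure: "K s \<subseteq> conv_closure X L (K s)" for s
    by (rule subset_conv_closure) (auto simp: K_def)
  have "\<Union>\<K> = X"
  proof
    show "\<Union>\<K> \<subseteq> X" by (auto simp: \<K>_def conv_closure_def)
    show "X \<subseteq> \<Union>\<K>"
    proof
      fix x assume "x \<in> X"
      then obtain n s where "s \<in> level n" "x \<in> K s" using covered by blast
      with K_closure[of s] show "x \<in> \<Union>\<K>" by (auto simp: \<K>_def)
    qed
  qed
  moreover have "countable \<K>"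
    using countable by (simp add: \<K>_def)
  moreover have "\<forall>K\<in>\<K>. conv_compact X L K"
    using compact legal by (auto simp: \<K>_def)
  ultimately show ?thesis by (intro exI[of _ \<K>] conjI)
qed

end
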